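(* Let $n\ge 1$ and let $i\colon\Delta S^n\to S^n\times S^n$ be the inclusion of the diagonal $\Delta S^n=\{(x,x): x\in S^n\}$. Then every map $f\colon\Delta S^n\to S^n\times S^n$ which is homotopic to $i$ has Lipschitz constant $\operatorname{Lip} f\ge 1$, and $\operatorname{Lip} f=1$ if and only if $f$ is isometric to the inclusion $i$.
   Context: $S^n$ is the round $n$-sphere of radius $1$ with its geodesic distance; $S^n\times S^n$ has the (Riemannian) product metric, and $\Delta S^n$ has the metric inherited from $S^n\times S^n$, which makes it isometric to a round $n$-sphere of radius $\sqrt2$. Maps are continuous. For a continuous map $f\colon X\to Y$ of metric spaces, $\operatorname{Lip} f$ is the smallest $c\ge 0$ such that $d(f(x),f(x'))\le c\,d(x,x')$ for all $x,x'\in X$ (and $\infty$ if no such $c$ exists). Two maps $f_1,f_2\colon X\to Y$ between metric spaces are isometric if there are isometries $g_X\colon X\to X$ and $g_Y\colon Y\to Y$ (from each space onto itself) with $g_Y f_1=f_2 g_X$. *)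

theory Defs
  imports "HOL-Analysis.Analysis"
begin

(* A metric space is given by a carrier set together with a distance function on it. *)

(* The unit sphere S^n, where DIM('a) = n + 1. *)
abbreviation unit_sphere :: "'a::euclidean_space set"
  where "unit_sphere \<equiv> sphere 0 1"

(* On unit vectors: the angle between x and y, i.e. the length of a shortest great-circle arc.
   It induces the Euclidean subspace topology on the sphere, so continuity and homotopy can be
   taken with respect to the latter. *)
definition geodesic_dist :: "'a::euclidean_space \<Rightarrow> 'a \<Rightarrow> real"
  where "geodesic_dist x y = arccos (x \<bullet> y)"

(* prod_dist is the l2 combination of the two distances, which is the distance of the Riemannian
   product metric. *)
definition sphere_prod_dist :: "'a::euclidean_space \<times> 'a \<Rightarrow> 'a \<times> 'a \<Rightarrow> real"
  where "sphere_prod_dist = prod_dist geodesic_dist geodesic_dist"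

(* Always used with the restriction of sphere_prod_dist, so that the distance of (x, x) and (y, y)
   is sqrt 2 * geodesic_dist x y. *)
definition sphere_diagonal :: "('a::euclidean_space \<times> 'a) set"
  where "sphere_diagonal = {(x, x) | x. x \<in> unit_sphere}"

(* The infimum is attained whenever the set is nonempty, and Inf {} = \<infinity>. *)
definition Lip :: "'a set \<Rightarrow> ('a \<Rightarrow> 'a \<Rightarrow> real) \<Rightarrow> ('b \<Rightarrow> 'b \<Rightarrow> real) \<Rightarrow> ('a \<Rightarrow> 'b) \<Rightarrow> ereal"
  where "Lip X dX dY f =
    Inf {ereal c | c. 0 \<le> c \<and> (\<forall>x\<in>X. \<forall>x'\<in>X. dY (f x) (f x') \<le> c * dX x x')}"

definition self_isometry :: "'a set \<Rightarrow> ('a \<Rightarrow> 'a \<Rightarrow> real) \<Rightarrow> ('a \<Rightarrow> 'a) \<Rightarrow> bool"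
  where "self_isometry X d g \<longleftrightarrow> g ` X = X \<and> (\<forall>x\<in>X. \<forall>x'\<in>X. d (g x) (g x') = d x x')"

definition isometric_maps ::
  "'a set \<Rightarrow> ('a \<Rightarrow> 'a \<Rightarrow> real) \<Rightarrow> 'b set \<Rightarrow> ('b \<Rightarrow> 'b \<Rightarrow> real) \<Rightarrow> ('a \<Rightarrow> 'b) \<Rightarrow> ('a \<Rightarrow> 'b) \<Rightarrow> bool"
  where "isometric_maps X dX Y dY f1 f2 \<longleftrightarrow>
    (\<exists>gX gY. self_isometry X dX gX \<and> self_isometry Y dY gY \<and> (\<forall>x\<in>X. gY (f1 x) = f2 (gX x)))"

end

theory Submission
  imports Defs "HOL-Homology.Homology"
begin

text \<open>
  Write \<open>f (x, x) = (u x, v x)\<close>. Projecting the homotopy, both \<open>u\<close> and \<open>v\<close> are maps of the sphere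
  to itself that are homotopic to the identity, and \<open>Lip f \<le> c\<close> says that
  \<open>\<theta>(u x, u y)\<^sup>2 + \<theta>(v x, v y)\<^sup>2 \<le> 2 c\<^sup>2 \<theta>(x, y)\<^sup>2\<close>, where \<open>\<theta>\<close> is the geodesic distance. In particular
  \<open>\<theta>(u x, u y) + \<theta>(v x, v y) \<le> 2 c \<theta>(x, y)\<close>.

  Suppose \<open>c \<le> 1\<close>. There is a point \<open>x\<close> with \<open>u (- x) = - u x\<close>: otherwise \<open>u\<close> would be homotopic to
  the normalisation of \<open>u x + u (- x)\<close>, which is an even map and so has even degree, whereas \<open>u\<close> has
  degree 1. For every \<open>z\<close> the distances from \<open>u z\<close> to \<open>u x\<close> and to \<open>u (- x)\<close> add up to \<open>\<pi>\<close>, as do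
  those from \<open>z\<close> to \<open>x\<close> and to \<open>- x\<close>. Adding the linear inequality for the pairs \<open>(x, z)\<close> and
  \<open>(- x, z)\<close> therefore leaves at most \<open>2 c \<pi> - \<pi> \<le> \<pi>\<close> for the two distances from \<open>v z\<close> to \<open>v x\<close> and to
  \<open>v (- x)\<close>. If \<open>v (- x) \<noteq> - v x\<close>, choose \<open>z\<close> such that \<open>v z\<close> points opposite to \<open>v x + v (- x)\<close>,
  which is possible because \<open>v\<close> is onto; then these two distances add up to more than \<open>\<pi>\<close>, a
  contradiction. So \<open>v (- x) = - v x\<close>, the two distances add up to exactly \<open>\<pi>\<close>, whence \<open>c = 1\<close>, all
  inequalities are equalities, and \<open>\<theta>(u x, u z) = \<theta>(v x, v z) = \<theta>(x, z)\<close> for all \<open>z\<close>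
  (\<open>antipode_rigidity\<close>). This already excludes \<open>c < 1\<close>.

  For \<open>c = 1\<close> it remains to get this rigidity at all points and not only at the one found above. Let
  \<open>T\<close> be the set of vectors \<open>w\<close> such that \<open>w \<bullet> z\<close> is a linear function of \<open>u z\<close> and also one of \<open>v z\<close>.
  It is a linear subspace that contains every rigid point. If it were proper, let \<open>a\<close> be the
  reflection fixing \<open>T\<close> and negating its orthogonal complement. The degree argument works for \<open>a\<close>
  in place of the antipodal map and gives \<open>z\<close> with \<open>u (a z) = - u z\<close>
  (\<open>coincidence_with_antipode\<close>). Since \<open>u z\<close> determines the \<open>T\<close>-component of \<open>z\<close> linearly, this
  component is zero, so \<open>a z = - z\<close> and \<open>z\<close> is a rigid point outside \<open>T\<close>, which is absurd. Hence
  \<open>T\<close> is everything, \<open>u\<close> and \<open>v\<close> are isometries, and \<open>u\<^sup>-\<^sup>1 \<times> v\<^sup>-\<^sup>1\<close> carries \<open>f\<close> to the inclusion.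

  The evenness of the degree (\<open>even_degree_of_involution_invariant\<close>) is a computation in relative
  homology. It needs the image of an equator to be contained in a contractible set, and this is where
  the Lipschitz condition enters: it makes that image negligible in the sphere, so that it misses a point.
\<close>

section \<open>Degrees of maps invariant under an involution\<close>

text \<open>
  The homology of the sphere relative to an equator splits into the contributions of the two closed
  hemispheres; the second isomorphism is the one that detects the two summands separately. Both
  isomorphisms come from excision.
\<close>

lemma hemisphere_homology_decomposition:
  fixes n k :: nat and p :: int
  defines "X \<equiv> nsphere n" and "E \<equiv> topspace (nsphere n) \<inter> {x. x k = 0}"
    and "L \<equiv> topspace (nsphere n) \<inter> {x. x k \<le> 0}"
    and "U \<equiv> topspace (nsphere n) \<inter> {x. x k \<ge> 0}"
  defines "H \<equiv> relative_homology_group p"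
    and "i \<equiv> hom_induced p (subtopology X L) E X E id"
    and "j \<equiv> hom_induced p (subtopology X U) E X E id"
    and "f \<equiv> hom_induced p X E X U id" and "g \<equiv> hom_induced p X E X L id"
  shows "(\<lambda>(x, y). i x \<otimes>\<^bsub>H X E\<^esub> j y)
           \<in> Group.iso (H (subtopology X L) E \<times>\<times> H (subtopology X U) E) (H X E)"
    and "(\<lambda>z. (f z, g z)) \<in> Group.iso (H X E) (H X U \<times>\<times> H X L)"
    and "exact_seq ([H X L, H X E, H (subtopology X L) E], [g, i])"
    and "exact_seq ([H X U, H X E, H (subtopology X U) E], [f, j])"
proof -
  have top: "topspace (subtopology X L) \<inter> {x. x k = 0} = E"
            "topspace (subtopology X U) \<inter> {x. x k = 0} = E"
    by (auto simp: E_def L_def U_def X_def)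
  have sub: "subtopology X {x. x k \<le> 0} = subtopology X L" "subtopology X {x. x k \<ge> 0} = subtopology X U"
    unfolding L_def U_def X_def by (simp_all add: subtopology_restrict)
  have isoL: "hom_induced p (subtopology X L) E X U id
              \<in> Group.iso (H (subtopology X L) E) (H X U)"
    using iso_relative_homology_group_lower_hemisphere [of p n k] top sub
      hom_induced_restrict [of p "subtopology X L" "{x. x k = 0}" X "{x. x k \<ge> 0}"]
      relative_homology_group_restrict [of p "subtopology X L" "{x. x k = 0}"]
      relative_homology_group_restrict [of p X "{x. x k \<ge> 0}"]
    by (simp add: H_def U_def flip: X_def)
  have isoU: "hom_induced p (subtopology X U) E X L id
              \<in> Group.iso (H (subtopology X U) E) (H X L)"
    using iso_relative_homology_group_upper_hemisphere [of p n k] top sub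
      hom_induced_restrict [of p "subtopology X U" "{x. x k = 0}" X "{x. x k \<le> 0}"]
      relative_homology_group_restrict [of p "subtopology X U" "{x. x k = 0}"]
      relative_homology_group_restrict [of p X "{x. x k \<le> 0}"]
    by (simp add: H_def L_def flip: X_def)
  have EL: "E \<subseteq> L" "E \<subseteq> U"
    by (auto simp: E_def L_def U_def)
  show exL: "exact_seq ([H X L, H X E, H (subtopology X L) E], [g, i])"
    unfolding H_def g_def i_def using EL(1) by (rule homology_exactness_triple_3)
  show exU: "exact_seq ([H X U, H X E, H (subtopology X U) E], [f, j])"
    unfolding H_def f_def j_def using EL(2) by (rule homology_exactness_triple_3)
  have "f (i x) = hom_induced p (subtopology X L) E X U id x" for x
    using EL unfolding f_def i_def by (simp add: hom_induced_compose' subset_iff)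
  moreover have "g (j x) = hom_induced p (subtopology X U) E X L id x" for x
    using EL unfolding g_def j_def by (simp add: hom_induced_compose' subset_iff)
  moreover have "comm_group (H X E)"
    by (simp add: H_def)
  ultimately have "(\<lambda>(x, y). i x \<otimes>\<^bsub>H X E\<^esub> j y)
           \<in> Group.iso (H (subtopology X L) E \<times>\<times> H (subtopology X U) E) (H X E) \<and>
         (\<lambda>z. (f z, g z)) \<in> Group.iso (H X E) (H X U \<times>\<times> H X L)"
    using isoL isoU exL exU by (intro exact_sequence_sum_lemma) auto
  then show "(\<lambda>(x, y). i x \<otimes>\<^bsub>H X E\<^esub> j y)
           \<in> Group.iso (H (subtopology X L) E \<times>\<times> H (subtopology X U) E) (H X E)"
    and "(\<lambda>z. (f z, g z)) \<in> Group.iso (H X E) (H X U \<times>\<times> H X L)"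
    by auto
qed

text \<open>
  Let \<open>c\<close> generate the top homology. Relative to the equator \<open>E\<close> it decomposes as \<open>\<alpha> + \<beta>\<close> along the
  two hemispheres. The involution \<open>A\<close> exchanges the hemispheres and has degree \<open>\<epsilon> = \<plusminus>1\<close>, so it maps
  \<open>\<alpha>\<close> to \<open>\<epsilon> \<beta>\<close>. As \<open>g\<close> does not see \<open>A\<close>, the image of \<open>\<beta>\<close> under \<open>g\<close> is \<open>\<epsilon>\<close> times that of \<open>\<alpha>\<close>, and
  \<open>c\<close> is mapped to \<open>1 + \<epsilon>\<close> times a class. That class lives in the homology relative to \<open>V\<close>, which
  is the absolute one since \<open>V\<close> is contractible.
\<close>

lemma even_degree_of_involution_invariant:
  fixes n k :: nat and A g :: "(nat \<Rightarrow> real) \<Rightarrow> nat \<Rightarrow> real"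
  assumes n: "n \<ge> 1"
    and contA: "continuous_map (nsphere n) (nsphere n) A"
    and AA: "\<And>x. x \<in> topspace (nsphere n) \<Longrightarrow> A (A x) = x"
    and Ak: "\<And>x. x \<in> topspace (nsphere n) \<Longrightarrow> A x k = - x k"
    and contg: "continuous_map (nsphere n) (nsphere n) g"
    and gA: "\<And>x. x \<in> topspace (nsphere n) \<Longrightarrow> g (A x) = g x"
    and gV: "\<And>x. \<lbrakk>x \<in> topspace (nsphere n); x k = 0\<rbrakk> \<Longrightarrow> g x \<in> V"
    and V: "contractible_space (subtopology (nsphere n) V)" "topspace (nsphere n) \<inter> V \<noteq> {}"
  shows "even (Brouwer_degree2 n g)"
proof -
  define X where "X \<equiv> nsphere n"
  define E where "E \<equiv> topspace X \<inter> {x. x k = 0}"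
  define L where "L \<equiv> topspace X \<inter> {x. x k \<le> 0}"
  define U where "U \<equiv> topspace X \<inter> {x. x k \<ge> 0}"
  let ?H = "relative_homology_group (int n) X"
  let ?h = "\<lambda>S T. hom_induced (int n) X S X T"
  have cA: "continuous_map X X A" and cg: "continuous_map X X g"
    using contA contg by (simp_all add: X_def)
  have Atop: "A x \<in> topspace X" if "x \<in> topspace X" for x
    using cA that continuous_map_image_subset_topspace by blast
  have AE: "A \<in> E \<rightarrow> E" "A \<in> L \<rightarrow> U" "A \<in> U \<rightarrow> L"
    using Atop Ak by (auto simp: E_def L_def U_def X_def)
  have EL: "id \<in> E \<rightarrow> L" "id \<in> E \<rightarrow> U" and gE: "g \<in> E \<rightarrow> V"
    using gV by (auto simp: E_def L_def U_def X_def)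
  have hom: "group_hom (?H S) (?H T) (?h S T f)" for S T f
    by (simp add: group_hom_axioms_def group_hom_def hom_induced_hom)
  have red: "reduced_homology_group n X = ?H {}"
    using n by (simp add: un_reduced_homology_group)
  interpret GE: comm_group "?H E" by simp
  interpret GV: comm_group "?H V" by simp
  interpret G0: comm_group "?H {}" by simp
  interpret hA: group_hom "?H E" "?H E" "?h E E A" by (rule hom)
  interpret hg: group_hom "?H E" "?H V" "?h E V g" by (rule hom)
  interpret hU: group_hom "?H E" "?H U" "?h E U id" by (rule hom)
  interpret hL: group_hom "?H E" "?H L" "?h E L id" by (rule hom)
  interpret jE: group_hom "?H {}" "?H E" "?h {} E id" by (rule hom)
  interpret jV: group_hom "?H {}" "?H V" "?h {} V id" by (rule hom)
  obtain c where c: "c \<in> carrier (?H {})" and cgen: "subgroup_generated (?H {}) {c} = ?H {}"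
    using cyclic_reduced_homology_group_nsphere [of n n] red by (auto simp: cyclic_group_def X_def)
  note decomp = hemisphere_homology_decomposition [where n=n and k=k and p="int n", folded X_def, folded E_def L_def U_def]
  define e where "e = ?h {} E id c"
  have ecarr: "e \<in> carrier (?H E)"
    by (simp add: e_def hom_induced_carrier)
  obtain p q where pq: "e = hom_induced n (subtopology X L) E X E id p \<otimes>\<^bsub>?H E\<^esub>
            hom_induced n (subtopology X U) E X E id q"
    and p: "p \<in> carrier (relative_homology_group n (subtopology X L) E)"
    and q: "q \<in> carrier (relative_homology_group n (subtopology X U) E)"
  proof -
    have "e \<in> (\<lambda>(x, y). hom_induced n (subtopology X L) E X E id x \<otimes>\<^bsub>?H E\<^esub>
                        hom_induced n (subtopology X U) E X E id y) `
              carrier (relative_homology_group n (subtopology X L) E \<times>\<times>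
                       relative_homology_group n (subtopology X U) E)"
      using decomp(1) ecarr by (simp add: iso_iff)
    then show thesis
      using that by auto
  qed
  define \<alpha> where "\<alpha> = hom_induced n (subtopology X L) E X E id p"
  define \<beta> where "\<beta> = hom_induced n (subtopology X U) E X E id q"
  have carr: "\<alpha> \<in> carrier (?H E)" "\<beta> \<in> carrier (?H E)"
    by (simp_all add: \<alpha>_def \<beta>_def hom_induced_carrier)
  have e: "e = \<alpha> \<otimes>\<^bsub>?H E\<^esub> \<beta>" by (simp add: pq \<alpha>_def \<beta>_def)
  have alpha_L: "?h E L id \<alpha> = \<one>\<^bsub>?H L\<^esub>" and beta_U: "?h E U id \<beta> = \<one>\<^bsub>?H U\<^esub>"
    using decomp(3,4) p q by (auto simp: \<alpha>_def \<beta>_def kernel_def)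
  have "?h E U id (?h E E A \<alpha>) = ?h L U A (?h E L id \<alpha>)"
    using cA AE EL by (simp add: hom_induced_compose')
  moreover have "?h E L id (?h E E A \<beta>) = ?h U L A (?h E U id \<beta>)"
    using cA AE EL by (simp add: hom_induced_compose')
  moreover have "?h L U A \<one>\<^bsub>?H L\<^esub> = \<one>\<^bsub>?H U\<^esub>" "?h U L A \<one>\<^bsub>?H U\<^esub> = \<one>\<^bsub>?H L\<^esub>"
    by (rule group_hom.hom_one [OF hom])+
  ultimately have image_alpha_U: "?h E U id (?h E E A \<alpha>) = \<one>\<^bsub>?H U\<^esub>"
    and image_beta_L: "?h E L id (?h E E A \<beta>) = \<one>\<^bsub>?H L\<^esub>"
    by (simp_all add: alpha_L beta_U del: one_relative_homology_group)
  define \<epsilon> where "\<epsilon> = Brouwer_degree2 n A"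
  have "\<bar>\<epsilon>\<bar> = 1"
    unfolding \<epsilon>_def
    by (rule Brouwer_degree2_homeomorphic_map)
       (metis homeomorphic_map_maps homeomorphic_maps_involution contA AA)
  then have eps: "\<epsilon> * \<epsilon> = 1" "even (1 + \<epsilon>)"
    by (auto simp: abs_if split: if_splits)
  have Ae: "?h E E A e = e [^]\<^bsub>?H E\<^esub> \<epsilon>"
  proof -
    have "?h E E A e = ?h {} E id (?h {} {} A c)"
      using cA AE by (simp add: e_def hom_induced_compose')
    also have "?h {} {} A c = c [^]\<^bsub>?H {}\<^esub> \<epsilon>"
      using Brouwer_degree2 [of c n A] c red by (simp add: \<epsilon>_def X_def)
    finally show ?thesis
      using jE.hom_int_pow [OF c] by (simp only: e_def)
  qed
  \<comment> \<open>Both sides vanish relative to \<open>U\<close>. Relative to \<open>L\<close> they agree, because there \<open>e\<close> reduces to \<open>\<beta>\<close>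
    and its image under \<open>A\<close> to that of \<open>\<alpha>\<close>.\<close>
  have image_alpha: "?h E E A \<alpha> = \<beta> [^]\<^bsub>?H E\<^esub> \<epsilon>"
  proof -
    have "?h E L id (?h E E A \<alpha>) = ?h E L id (?h E E A e)"
      using carr by (simp add: e image_beta_L hom_induced_carrier del: one_relative_homology_group)
    also have "\<dots> = ?h E L id (\<beta> [^]\<^bsub>?H E\<^esub> \<epsilon>)"
      unfolding Ae using carr by (simp add: e GE.int_pow_distrib hL.hom_int_pow alpha_L del: one_relative_homology_group)
    finally have 1: "?h E L id (?h E E A \<alpha>) = ?h E L id (\<beta> [^]\<^bsub>?H E\<^esub> \<epsilon>)" .
    have 2: "?h E U id (?h E E A \<alpha>) = ?h E U id (\<beta> [^]\<^bsub>?H E\<^esub> \<epsilon>)"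
      using carr by (simp add: hU.hom_int_pow beta_U image_alpha_U del: one_relative_homology_group)
    have "inj_on (\<lambda>z. (?h E U id z, ?h E L id z)) (carrier (?H E))"
      using decomp(2) by (simp add: iso_iff)
    then show ?thesis
      using 1 2 carr by (auto simp: inj_on_def hom_induced_carrier)
  qed
  define \<gamma> where "\<gamma> = ?h E V g \<alpha>"
  have \<gamma>carr: "\<gamma> \<in> carrier (?H V)"
    by (simp add: \<gamma>_def hom_induced_carrier)
  have g_after_A: "?h E V g (?h E E A x) = ?h E V g x" for x
  proof -
    have "?h E V g (?h E E A x) = ?h E V (g \<circ> A) x"
      using cA cg AE gE by (simp add: hom_induced_compose')
    also have "?h E V (g \<circ> A) = ?h E V g"
      using gA by (intro hom_induced_eq) (simp add: X_def)
    finally show ?thesis .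
  qed
  have "?h E V g \<beta> = ?h E V g (?h E E A \<alpha> [^]\<^bsub>?H E\<^esub> \<epsilon>)"
    using carr eps by (simp add: image_alpha GE.int_pow_pow)
  also have "\<dots> = ?h E V g (?h E E A \<alpha>) [^]\<^bsub>?H V\<^esub> \<epsilon>"
    by (rule hg.hom_int_pow) (simp add: hom_induced_carrier)
  also have "\<dots> = \<gamma> [^]\<^bsub>?H V\<^esub> \<epsilon>"
    by (simp only: g_after_A \<gamma>_def)
  finally have g_beta: "?h E V g \<beta> = \<gamma> [^]\<^bsub>?H V\<^esub> \<epsilon>" .
  have "?h E V g e = \<gamma> \<otimes>\<^bsub>?H V\<^esub> \<gamma> [^]\<^bsub>?H V\<^esub> \<epsilon>"
    unfolding e by (simp only: hg.hom_mult carr g_beta flip: \<gamma>_def)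
  also have "\<dots> = \<gamma> [^]\<^bsub>?H V\<^esub> (1 + \<epsilon>)"
    using GV.int_pow_mult [OF \<gamma>carr, of 1 \<epsilon>] GV.int_pow_1 [OF \<gamma>carr] by simp
  finally have ge: "?h E V g e = \<gamma> [^]\<^bsub>?H V\<^esub> (1 + \<epsilon>)" .
  have isoV: "?h {} V id \<in> Group.iso (?H {}) (?H V)"
    using iso_reduced_homology_by_contractible [OF V, of "int n", folded X_def] unfolding red .
  then obtain c' where c': "c' \<in> carrier (?H {})" "?h {} V id c' = \<gamma>"
    using \<gamma>carr by (metis (no_types, lifting) iso_iff imageE)
  have "c' \<in> carrier (subgroup_generated (?H {}) {c})"
    using c' cgen by simp
  then obtain m :: int where m: "c' = c [^]\<^bsub>?H {}\<^esub> m"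
    unfolding G0.carrier_subgroup_generated_by_singleton [OF c] by (rule rangeE)
  have "?h {} V id (?h {} {} g c) = ?h E V g e"
    unfolding e_def using cg gE by (simp add: hom_induced_compose')
  also have "\<dots> = ?h {} V id (c' [^]\<^bsub>?H {}\<^esub> (1 + \<epsilon>))"
    by (simp only: ge jV.hom_int_pow [OF c'(1)] c'(2))
  also have "c' [^]\<^bsub>?H {}\<^esub> (1 + \<epsilon>) = c [^]\<^bsub>?H {}\<^esub> (m * (1 + \<epsilon>))"
    by (simp only: m G0.int_pow_pow [OF c])
  finally have "?h {} V id (?h {} {} g c) = ?h {} V id (c [^]\<^bsub>?H {}\<^esub> (m * (1 + \<epsilon>)))" .
  moreover have "inj_on (?h {} V id) (carrier (?H {}))"
    using isoV by (simp add: iso_iff)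
  ultimately have "?h {} {} g c = c [^]\<^bsub>?H {}\<^esub> (m * (1 + \<epsilon>))"
    using G0.int_pow_closed [OF c] hom_induced_carrier by (metis inj_onD)
  then have "Brouwer_degree2 n g = m * (1 + \<epsilon>)"
    using contg cgen by (intro Brouwer_degree2_unique_generator [where a = c]) (simp_all only: red flip: X_def)
  then show ?thesis
    using eps by simp
qed

text \<open>
  The degree theory is about spheres in coordinates. The identification is chosen such that the
  given unit vector becomes a coordinate axis and its equator a coordinate equator.
\<close>

lemma sphere_homeomorphic_nsphere:
  fixes w :: "'a::euclidean_space"
  assumes w: "norm w = 1" and n: "DIM('a) = n + 1"
  obtains h h' k where "homeomorphic_maps (top_of_set unit_sphere) (nsphere n) h h'"
    and "\<And>x. h x k = x \<bullet> w"
proof -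
  obtain B where B: "w \<in> B" "pairwise orthogonal B" "\<And>x. x \<in> B \<Longrightarrow> norm x = 1"
    "independent B" "card B = DIM('a)" "span B = UNIV"
    using vector_in_orthonormal_basis [OF w] by metis
  have fin: "finite B"
    using B(4) finiteI_independent by blast
  then obtain b where "bij_betw b {0..<card B} B"
    using ex_bij_betw_nat_finite by blast
  moreover have "{0..<card B} = {..n}"
    using B n by auto
  ultimately have b: "bij_betw b {..n} B"
    by simp
  then obtain k where k: "k \<le> n" "b k = w"
    using B(1) by (metis atMost_iff bij_betw_imp_surj_on imageE)
  have ortho: "b i \<bullet> b j = (if i = j then 1 else 0)" if "i \<le> n" "j \<le> n" for i j
  proof (cases "i = j")
    case True
    then show ?thesis
      using that B(3) [of "b i"] b by (auto simp: bij_betw_def dot_square_norm)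
  next
    case False
    then have "b i \<noteq> b j"
      using that b by (auto simp: bij_betw_def inj_on_def)
    then show ?thesis
      using False that B(2) b by (auto simp: bij_betw_def pairwise_def orthogonal_def)
  qed
  have expand: "(\<Sum>i\<le>n. (x \<bullet> b i) *\<^sub>R b i) = x" for x
  proof -
    have "(\<Sum>i\<le>n. (x \<bullet> b i) *\<^sub>R b i) = (\<Sum>u\<in>B. (x \<bullet> u) *\<^sub>R u)"
      by (rule sum.reindex_bij_betw [OF b])
    then show ?thesis
      using B fin by (simp add: orthonormal_basis_expand)
  qed
  have coord: "(\<Sum>j\<le>n. y j *\<^sub>R b j) \<bullet> b i = y i" if "i \<le> n" for y i
    using that by (simp add: inner_sum_left ortho if_distrib cong: if_cong)
  have sq: "(\<Sum>i\<le>n. (x \<bullet> b i)\<^sup>2) = x \<bullet> x" for x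
  proof -
    have "(\<Sum>i\<le>n. (x \<bullet> b i)\<^sup>2) = x \<bullet> (\<Sum>i\<le>n. (x \<bullet> b i) *\<^sub>R b i)"
      by (simp add: inner_sum_right power2_eq_square)
    then show ?thesis
      by (simp only: expand)
  qed
  define h where "h = (\<lambda>x i. if i \<le> n then x \<bullet> b i else 0)"
  define h' where "h' = (\<lambda>y::nat \<Rightarrow> real. \<Sum>i\<le>n. y i *\<^sub>R b i)"
  have h'h: "h' (h x) = x" for x
    using expand [of x] by (simp add: h'_def h_def)
  have hh': "h (h' y) = y" if "y \<in> topspace (nsphere n)" for y
    using that coord by (auto simp: h_def h'_def nsphere)
  have "homeomorphic_maps (top_of_set unit_sphere) (nsphere n) h h'"
    unfolding homeomorphic_maps_def
  proof (intro conjI ballI)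
    have "continuous_map (top_of_set unit_sphere) euclideanreal (\<lambda>x. h x i)" for i
      by (auto simp: h_def intro!: continuous_intros)
    moreover have "h x \<in> {y. (\<Sum>i\<le>n. (y i)\<^sup>2) = 1 \<and> (\<forall>i>n. y i = 0)}" if "x \<in> unit_sphere" for x
      using that sq [of x] by (simp add: h_def dot_square_norm)
    ultimately show "continuous_map (top_of_set unit_sphere) (nsphere n) h"
      unfolding nsphere continuous_map_in_subtopology continuous_map_componentwise_UNIV by auto
    have "continuous_map (nsphere n) euclidean (\<lambda>y. y i *\<^sub>R b i)" for i
    proof -
      have "continuous_map euclideanreal euclidean (\<lambda>t. t *\<^sub>R b i)"
        by (auto intro!: continuous_intros)
      from continuous_map_compose [OF continuous_map_nsphere_projection this]
      show ?thesis
        unfolding o_def .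
    qed
    then have "continuous_map (nsphere n) euclidean h'"
      unfolding h'_def by (intro continuous_map_sum) auto
    moreover have "h' y \<in> unit_sphere" if "y \<in> topspace (nsphere n)" for y
    proof -
      have "h' y \<bullet> h' y = (\<Sum>i\<le>n. (y i)\<^sup>2)"
        using sq [of "h' y"] by (simp add: h'_def coord)
      also have "\<dots> = 1"
        using that by (simp add: nsphere)
      finally show ?thesis
        by (simp add: norm_eq_1)
    qed
    ultimately show "continuous_map (nsphere n) (top_of_set unit_sphere) h'"
      by (auto simp: continuous_map_in_subtopology)
  qed (use h'h hh' in auto)
  moreover have "h x k = x \<bullet> w" for x
    using k by (simp add: h_def)
  ultimately show thesis
    using that by blast
qed


text \<open>
  An orthogonal involution that negates \<open>w\<close> exchanges the two hemispheres cut out by the equator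
  orthogonal to \<open>w\<close>. The set \<open>V\<close> of the degree computation is the complement of the missed point \<open>y\<close>.
\<close>

lemma invariant_sphere_map_not_homotopic_id:
  fixes a g :: "'a::euclidean_space \<Rightarrow> 'a"
  assumes dim: "DIM('a) \<ge> 2"
    and a: "orthogonal_transformation a" "\<And>x. a (a x) = x" and w: "norm w = 1" "a w = - w"
    and g: "\<And>x. x \<in> unit_sphere \<Longrightarrow> g (a x) = g x"
    and y: "y \<in> unit_sphere" "\<And>x. \<lbrakk>x \<in> unit_sphere; x \<bullet> w = 0\<rbrakk> \<Longrightarrow> g x \<noteq> y"
  shows "\<not> homotopic_with_canon (\<lambda>_. True) unit_sphere unit_sphere g id"
proof
  let ?S = "top_of_set (unit_sphere :: 'a set)"
  assume homotopic: "homotopic_with (\<lambda>_. True) ?S ?S g id"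
  then have contg: "continuous_map ?S ?S g"
    using homotopic_with_imp_continuous_maps by blast
  define n where "n = DIM('a) - 1"
  have n: "DIM('a) = n + 1" "n \<ge> 1"
    using dim by (auto simp: n_def)
  let ?N = "nsphere n"
  obtain h h' k where hh: "homeomorphic_maps ?S ?N h h'" and hk: "\<And>x. h x k = x \<bullet> w"
    using sphere_homeomorphic_nsphere [OF w(1) n(1)] by blast
  then have conth: "continuous_map ?S ?N h" "continuous_map ?N ?S h'"
    and h'h: "\<And>x. x \<in> unit_sphere \<Longrightarrow> h' (h x) = x"
    and hh': "\<And>x. x \<in> topspace ?N \<Longrightarrow> h (h' x) = x"
    by (auto simp: homeomorphic_maps_def)
  have h'S: "h' x \<in> unit_sphere" if "x \<in> topspace ?N" for x
    using continuous_map_image_subset_topspace [OF conth(2)] that by auto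
  have hN: "h x \<in> topspace ?N" if "x \<in> unit_sphere" for x
    using continuous_map_image_subset_topspace [OF conth(1)] that by (simp add: image_subset_iff)
  have gS: "g x \<in> unit_sphere" if "x \<in> unit_sphere" for x
    using continuous_map_image_subset_topspace [OF contg] that by (simp add: image_subset_iff)
  have aS: "a x \<in> unit_sphere \<longleftrightarrow> x \<in> unit_sphere" for x
    using a(1) by (simp add: orthogonal_transformation_norm)
  have conta: "continuous_map ?S ?S a"
    using aS linear_continuous_on [OF linear_conv_bounded_linear [THEN iffD1, OF orthogonal_transformation_linear [OF a(1)]]] by auto
  have aw: "a x \<bullet> w = - (x \<bullet> w)" for x
    using a w by (metis inner_minus_right orthogonal_transformation_def minus_minus)
  define A where "A = h \<circ> a \<circ> h'"
  define G where "G = h \<circ> g \<circ> h'"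
  define V where "V = topspace ?N - {h y}"
  have "even (Brouwer_degree2 n G)"
  proof (rule even_degree_of_involution_invariant [where A = A and k = k and V = V])
    show "continuous_map ?N ?N A" "continuous_map ?N ?N G"
      unfolding A_def G_def using conth conta contg by (blast intro: continuous_map_compose)+
    show "A (A x) = x" if "x \<in> topspace ?N" for x
      using that h'S aS by (simp add: A_def h'h hh' a)
    show "A x k = - x k" if "x \<in> topspace ?N" for x
      using that h'S hk hh' aw by (metis A_def comp_apply)
    show "G (A x) = G x" if "x \<in> topspace ?N" for x
      using that h'S aS by (simp add: A_def G_def h'h g)
    show "G x \<in> V" if "x \<in> topspace ?N" "x k = 0" for x
    proof -
      have "h' x \<bullet> w = 0"
        using that hk hh' by metis
      then have "g (h' x) \<noteq> y"
        using that y h'S by blast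
      then have "h (g (h' x)) \<noteq> h y"
        using that y h'S gS h'h by metis
      then show ?thesis
        using that h'S gS hN by (simp add: G_def V_def)
    qed
    have "h x \<noteq> h y" if "x \<in> unit_sphere" "x \<noteq> y" for x
      using that y h'h by metis
    then have "homeomorphic_maps (subtopology ?S (unit_sphere - {y})) (subtopology ?N V) h h'"
      using hN h'S h'h hh' y by (intro homeomorphic_maps_subtopologies_alt [OF hh]) (auto simp: V_def)
    then have "top_of_set (unit_sphere - {y}) homeomorphic_space subtopology ?N V"
      by (metis Diff_subset homeomorphic_space_def inf.absorb_iff2 subtopology_subtopology)
    moreover have "contractible (unit_sphere - {y})"
    proof -
      have "w \<noteq> 0" using w by auto
      then have "unit_sphere - {y} homeomorphic {x. w \<bullet> x = 0}"
        using y by (intro homeomorphic_punctured_sphere_hyperplane) auto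
      then show ?thesis
        using convex_hyperplane convex_imp_contractible homeomorphic_contractible_eq by blast
    qed
    ultimately show "contractible_space (subtopology ?N V)"
      using homeomorphic_space_contractibility contractible_space_top_of_set by blast
    have "- y \<noteq> y"
    proof
      assume "- y = y"
      then have "2 *\<^sub>R y = 0"
        by (metis add.right_inverse scaleR_2)
      then show False
        using y by simp
    qed
    moreover have "- y \<in> unit_sphere"
      using y by simp
    ultimately have "h (- y) \<noteq> h y" "h (- y) \<in> topspace ?N"
      using y h'h hN by metis+
    then have "h (- y) \<in> V"
      by (simp add: V_def)
    then show "topspace ?N \<inter> V \<noteq> {}"
      by (auto simp: V_def)
  qed (fact n)
  moreover have "homotopic_with (\<lambda>_. True) ?N ?N G id"
  proof -
    have "homotopic_with (\<lambda>_. True) ?N ?S (g \<circ> h') (id \<circ> h')"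
      by (rule homotopic_with_compose_continuous_map_right [OF homotopic conth(2)]) simp
    then have "homotopic_with (\<lambda>_. True) ?N ?N (h \<circ> (g \<circ> h')) (h \<circ> (id \<circ> h'))"
      by (rule homotopic_with_compose_continuous_map_left [OF _ conth(1)]) simp
    then show ?thesis
      by (rule homotopic_with_eq) (simp_all add: G_def hh')
  qed
  then have "Brouwer_degree2 n G = 1"
    using Brouwer_degree2_homotopic Brouwer_degree2_id by metis
  ultimately show False
    by simp
qed

section \<open>Maps of the sphere homotopic to the identity\<close>

lemma homotopic_sphere_maps_nowhere_antipodal:
  fixes f g :: "'b::topological_space \<Rightarrow> 'a::euclidean_space"
  assumes f: "continuous_on X f" "f \<in> X \<rightarrow> unit_sphere"
    and g: "continuous_on X g" "g \<in> X \<rightarrow> unit_sphere"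
    and fg: "\<And>x. x \<in> X \<Longrightarrow> f x \<noteq> - g x"
  shows "homotopic_with_canon (\<lambda>_. True) X unit_sphere f g"
proof -
  have nz: "(1 - t) *\<^sub>R f x + t *\<^sub>R g x \<noteq> 0" if "x \<in> X" "0 \<le> t" "t \<le> 1" for x t
  proof
    assume "(1 - t) *\<^sub>R f x + t *\<^sub>R g x = 0"
    then have eq: "(1 - t) *\<^sub>R f x = t *\<^sub>R (- g x)"
      by (simp add: eq_neg_iff_add_eq_0)
    then have "norm ((1 - t) *\<^sub>R f x) = norm (t *\<^sub>R (- g x))"
      by (rule arg_cong)
    moreover have "norm (f x) = 1" "norm (g x) = 1"
      using f(2) g(2) \<open>x \<in> X\<close> by auto
    ultimately have "1 - t = t"
      using that by simp
    then have "t \<noteq> 0" and "t *\<^sub>R f x = t *\<^sub>R (- g x)"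
      using eq by (simp, simp only:)
    then show False
      using fg [OF \<open>x \<in> X\<close>] by (simp only: scaleR_cancel_left) simp
  qed
  have "homotopic_with_canon (\<lambda>_. True) X (- {0}) f g"
    using nz by (intro homotopic_with_linear f g) (force simp: closed_segment_def)
  then have "homotopic_with_canon (\<lambda>_. True) X unit_sphere (sgn \<circ> f) (sgn \<circ> g)"
    by (rule homotopic_with_compose_continuous_left)
       (auto simp: norm_sgn intro!: continuous_intros)
  then show ?thesis
  proof (rule homotopic_with_eq)
    show "f x = (sgn \<circ> f) x" "g x = (sgn \<circ> g) x" if "x \<in> topspace (top_of_set X)" for x
      using that f(2) g(2) by (auto simp: sgn_div_norm Pi_iff)
  qed auto
qed

text \<open>A map missing \<open>y\<close> is nowhere antipodal to the constant \<open>- y\<close>, and the sphere is not contractible.\<close>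

lemma sphere_map_homotopic_id_surj:
  fixes u :: "'a::euclidean_space \<Rightarrow> 'a"
  assumes u: "homotopic_with_canon (\<lambda>_. True) unit_sphere unit_sphere u id" and y: "y \<in> unit_sphere"
  shows "\<exists>x\<in>unit_sphere. u x = y"
proof (rule ccontr)
  assume "\<not> (\<exists>x\<in>unit_sphere. u x = y)"
  then have ne: "u x \<noteq> - (- y)" if "x \<in> unit_sphere" for x
    using that by auto
  have "continuous_on unit_sphere u" "u \<in> unit_sphere \<rightarrow> unit_sphere"
    using homotopic_with_imp_continuous [OF u] homotopic_with_imp_funspace1 [OF u] by auto
  then have "homotopic_with_canon (\<lambda>_. True) unit_sphere unit_sphere u (\<lambda>_. - y)"
    using y ne by (intro homotopic_sphere_maps_nowhere_antipodal) auto
  then have "contractible (unit_sphere :: 'a set)"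
    unfolding contractible_def using u homotopic_with_symD homotopic_with_trans by blast
  then show False
    by (simp add: contractible_sphere)
qed

text \<open>
  The cone over \<open>f\<close>, extended homogeneously, is still Lipschitz and maps the hyperplane orthogonal
  to \<open>w\<close> onto a negligible set. This set is a cone, so some direction is missing from it.
\<close>

lemma Lipschitz_image_of_equator_not_onto:
  fixes f :: "'a::euclidean_space \<Rightarrow> 'a"
  assumes lip: "\<And>x y. \<lbrakk>x \<in> unit_sphere; y \<in> unit_sphere\<rbrakk> \<Longrightarrow> norm (f x - f y) \<le> B * norm (x - y)"
    and bound: "\<And>x. x \<in> unit_sphere \<Longrightarrow> norm (f x) \<le> C"
    and nz: "\<And>x. x \<in> unit_sphere \<Longrightarrow> f x \<noteq> 0" and "w \<noteq> 0"
  obtains y where "y \<in> unit_sphere" "\<And>x. \<lbrakk>x \<in> unit_sphere; x \<bullet> w = 0\<rbrakk> \<Longrightarrow> sgn (f x) \<noteq> y"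
proof -
  define F where "F x = norm x *\<^sub>R f (sgn x)" for x
  define M where "M = {x. w \<bullet> x = 0} - {0}"
  have F_lip: "norm (F y - F x) \<le> (2 * \<bar>B\<bar> + C) * norm (y - x)" if "x \<in> M" "y \<in> M" for x y
  proof -
    have nz: "x \<noteq> 0" "y \<noteq> 0" and S: "sgn x \<in> unit_sphere" "sgn y \<in> unit_sphere"
      using that by (auto simp: M_def norm_sgn)
    have "norm y *\<^sub>R (sgn y - sgn x) = (y - x) + (norm x - norm y) *\<^sub>R sgn x"
      using nz by (simp add: sgn_div_norm algebra_simps)
    then have "norm (norm y *\<^sub>R (sgn y - sgn x)) \<le> norm (y - x) + norm ((norm x - norm y) *\<^sub>R sgn x)"
      by (metis norm_triangle_ineq)
    also have "\<dots> \<le> 2 * norm (y - x)"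
      using nz norm_triangle_ineq3 [of x y] by (simp add: norm_sgn norm_minus_commute)
    finally have A: "norm y * norm (sgn y - sgn x) \<le> 2 * norm (y - x)"
      by simp
    have "F y - F x = norm y *\<^sub>R (f (sgn y) - f (sgn x)) + (norm y - norm x) *\<^sub>R f (sgn x)"
      by (simp add: F_def algebra_simps)
    then have "norm (F y - F x) \<le> norm y * norm (f (sgn y) - f (sgn x)) + \<bar>norm y - norm x\<bar> * norm (f (sgn x))"
      by (metis norm_triangle_ineq norm_scaleR abs_norm_cancel)
    also have "norm y * norm (f (sgn y) - f (sgn x)) \<le> norm y * (\<bar>B\<bar> * norm (sgn y - sgn x))"
    proof (rule mult_left_mono)
      have "norm (f (sgn y) - f (sgn x)) \<le> B * norm (sgn y - sgn x)"
        using lip S by blast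
      also have "\<dots> \<le> \<bar>B\<bar> * norm (sgn y - sgn x)"
        by (intro mult_right_mono) auto
      finally show "norm (f (sgn y) - f (sgn x)) \<le> \<bar>B\<bar> * norm (sgn y - sgn x)" .
    qed auto
    also have "\<dots> = \<bar>B\<bar> * (norm y * norm (sgn y - sgn x))"
      by simp
    also have "\<dots> \<le> \<bar>B\<bar> * (2 * norm (y - x))"
      using A by (intro mult_left_mono) auto
    also have "\<bar>norm y - norm x\<bar> * norm (f (sgn x)) \<le> norm (y - x) * C"
      using bound [OF S(1)] norm_triangle_ineq3 [of y x] by (intro mult_mono) auto
    finally show ?thesis
      by (simp add: algebra_simps)
  qed
  have "negligible M"
    unfolding M_def using \<open>w \<noteq> 0\<close> negligible_hyperplane [of w 0] negligible_diff by blast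
  then have "negligible (F ` M)"
    using F_lip open_UNIV by (intro negligible_locally_Lipschitz_image) auto
  then have "negligible (insert 0 (F ` M))"
    by simp
  then obtain p where p: "p \<noteq> 0" "p \<notin> F ` M"
    by (metis UNIV_eq_I insertCI non_negligible_UNIV)
  show thesis
  proof
    show "sgn p \<in> unit_sphere"
      using p by (simp add: norm_sgn)
    show "sgn (f x) \<noteq> sgn p" if x: "x \<in> unit_sphere" "x \<bullet> w = 0" for x
    proof
      assume eq: "sgn (f x) = sgn p"
      define r where "r = norm p / norm (f x)"
      have r: "r > 0"
        using p nz [OF x(1)] by (simp add: r_def)
      have "r *\<^sub>R x \<in> M"
        using x r by (auto simp: M_def inner_commute)
      moreover have "F (r *\<^sub>R x) = p"
      proof -
        have "sgn (r *\<^sub>R x) = x"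
          using x r by (simp add: sgn_scaleR sgn_div_norm)
        then have "F (r *\<^sub>R x) = r *\<^sub>R f x"
          using x r by (simp add: F_def)
        also have "\<dots> = norm p *\<^sub>R sgn (f x)"
          by (simp add: r_def sgn_div_norm divide_inverse)
        finally show ?thesis
          using p unfolding eq by (simp add: sgn_div_norm)
      qed
      ultimately show False
        using p by blast
    qed
  qed
qed

text \<open>
  Otherwise \<open>u x + u (a x)\<close> never vanishes, and its normalisation is an \<open>a\<close>-invariant map that is
  nowhere antipodal to \<open>u\<close>, hence homotopic to the identity.
\<close>

lemma coincidence_with_antipode:
  fixes a u :: "'a::euclidean_space \<Rightarrow> 'a"
  assumes dim: "DIM('a) \<ge> 2"
    and a: "orthogonal_transformation a" "\<And>x. a (a x) = x" and w: "norm w = 1" "a w = - w"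
    and lip: "\<And>x y. \<lbrakk>x \<in> unit_sphere; y \<in> unit_sphere\<rbrakk> \<Longrightarrow> norm (u x - u y) \<le> B * norm (x - y)"
    and u: "homotopic_with_canon (\<lambda>_. True) unit_sphere unit_sphere u id"
  obtains z where "z \<in> unit_sphere" "u (a z) = - u z"
proof (rule ccontr)
  assume "\<not> thesis"
  then have ne: "u (a z) \<noteq> - u z" if "z \<in> unit_sphere" for z
    using that \<open>\<And>z. \<lbrakk>z \<in> unit_sphere; u (a z) = - u z\<rbrakk> \<Longrightarrow> thesis\<close> by auto
  have contu: "continuous_on unit_sphere u" and uS: "u \<in> unit_sphere \<rightarrow> unit_sphere"
    using homotopic_with_imp_continuous [OF u] homotopic_with_imp_funspace1 [OF u] by auto
  have aS: "a x \<in> unit_sphere" if "x \<in> unit_sphere" for x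
    using a(1) that by (simp add: orthogonal_transformation_norm)
  have contua: "continuous_on unit_sphere (\<lambda>x. u (a x))"
    using aS linear_continuous_on [OF linear_conv_bounded_linear [THEN iffD1, OF orthogonal_transformation_linear [OF a(1)]]]
    by (intro continuous_on_compose2 [OF contu]) auto
  define f where "f x = u x + u (a x)" for x
  have f: "f x \<noteq> 0" if "x \<in> unit_sphere" for x
    using ne [OF that] by (metis f_def add_eq_0_iff)
  have contf: "continuous_on unit_sphere (\<lambda>x. sgn (f x))"
    using f unfolding f_def by (intro continuous_intros contu contua) auto
  have un: "norm (u x) = 1" if "x \<in> unit_sphere" for x
    using uS that by (auto simp: Pi_iff)
  obtain y where y: "y \<in> unit_sphere" "\<And>x. \<lbrakk>x \<in> unit_sphere; x \<bullet> w = 0\<rbrakk> \<Longrightarrow> sgn (f x) \<noteq> y"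
  proof (rule Lipschitz_image_of_equator_not_onto [of f "2 * B" 2 w])
    show "norm (f x - f y) \<le> 2 * B * norm (x - y)" if "x \<in> unit_sphere" "y \<in> unit_sphere" for x y
    proof -
      have "f x - f y = (u x - u y) + (u (a x) - u (a y))"
        by (simp add: f_def)
      then have "norm (f x - f y) \<le> norm (u x - u y) + norm (u (a x) - u (a y))"
        by (metis norm_triangle_ineq)
      moreover have "norm (a x - a y) = norm (x - y)"
        using linear_diff [OF orthogonal_transformation_linear [OF a(1)], of x y]
          orthogonal_transformation_norm [OF a(1), of "x - y"] by simp
      ultimately show ?thesis
        using lip [OF that] lip [OF aS aS, OF that] by simp
    qed
    show "norm (f x) \<le> 2" if "x \<in> unit_sphere" for x
      using norm_triangle_ineq [of "u x" "u (a x)"] un that aS by (simp add: f_def)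
  qed (use f w in auto)
  have "\<not> homotopic_with_canon (\<lambda>_. True) unit_sphere unit_sphere (\<lambda>x. sgn (f x)) id"
    by (rule invariant_sphere_map_not_homotopic_id [OF dim a w _ y])
       (auto simp: f_def a add.commute)
  moreover have "homotopic_with_canon (\<lambda>_. True) unit_sphere unit_sphere u (\<lambda>x. sgn (f x))"
  proof (rule homotopic_sphere_maps_nowhere_antipodal [OF contu uS contf])
    show "(\<lambda>x. sgn (f x)) \<in> unit_sphere \<rightarrow> unit_sphere"
      using f by (auto simp: norm_sgn)
    show "u x \<noteq> - sgn (f x)" if x: "x \<in> unit_sphere" for x
    proof
      assume eq: "u x = - sgn (f x)"
      have "u x \<bullet> f x = 1 + u x \<bullet> u (a x)"
        using un [OF x] by (simp add: f_def inner_add_right dot_square_norm)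
      moreover have "u x \<bullet> f x = - norm (f x)"
        using f [OF x] unfolding eq by (simp add: sgn_div_norm dot_square_norm power2_eq_square)
      moreover have "norm (f x) > 0"
        using f [OF x] by simp
      moreover have "\<bar>u x \<bullet> u (a x)\<bar> \<le> 1"
        using Cauchy_Schwarz_ineq2 [of "u x" "u (a x)"] un x aS by simp
      ultimately show False
        by linarith
    qed
  qed
  ultimately show False
    using u homotopic_with_symD homotopic_with_trans by blast
qed

section \<open>Geodesic distance and antipodal points\<close>

lemma abs_inner_unit_sphere_le_1:
  assumes "x \<in> unit_sphere" "y \<in> unit_sphere"
  shows "\<bar>x \<bullet> y\<bar> \<le> 1"
  using Cauchy_Schwarz_ineq2 [of x y] assms by simp

lemma geodesic_dist_nonneg:
  assumes "x \<in> unit_sphere" "y \<in> unit_sphere"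
  shows "0 \<le> geodesic_dist x y"
  using abs_inner_unit_sphere_le_1 [OF assms] unfolding geodesic_dist_def
  by (intro arccos_lbound) auto

lemma geodesic_dist_eq_iff:
  assumes "x \<in> unit_sphere" "y \<in> unit_sphere" "x' \<in> unit_sphere" "y' \<in> unit_sphere"
  shows "geodesic_dist x y = geodesic_dist x' y' \<longleftrightarrow> x \<bullet> y = x' \<bullet> y'"
  unfolding geodesic_dist_def using assms by (intro arccos_eq_iff) (simp add: abs_inner_unit_sphere_le_1)

lemma geodesic_dist_antipode:
  assumes "x \<in> unit_sphere" "y \<in> unit_sphere"
  shows "geodesic_dist (- x) y = pi - geodesic_dist x y"
  using abs_inner_unit_sphere_le_1 [OF assms] unfolding geodesic_dist_def
  by (simp add: arccos_minus)

lemma norm_diff_eq_chord: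
  assumes "x \<in> unit_sphere" "y \<in> unit_sphere"
  shows "norm (x - y) = 2 * sin (geodesic_dist x y / 2)"
proof -
  define t where "t = geodesic_dist x y"
  have bounds: "-1 \<le> x \<bullet> y" "x \<bullet> y \<le> 1"
    using abs_inner_unit_sphere_le_1 [OF assms] by auto
  then have t: "0 \<le> t" "t \<le> pi" "cos t = x \<bullet> y"
    using arccos [OF bounds] by (auto simp: t_def geodesic_dist_def)
  have "(norm (x - y))\<^sup>2 = 2 - 2 * (x \<bullet> y)"
    using assms by (simp add: power2_norm_eq_inner inner_diff_left inner_diff_right inner_commute norm_eq_1)
  also have "\<dots> = (2 * sin (t / 2))\<^sup>2"
    using cos_double_sin [of "t / 2"] t by (simp add: power_mult_distrib)
  finally have sq: "(norm (x - y))\<^sup>2 = (2 * sin (t / 2))\<^sup>2" .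
  have nonneg: "0 \<le> 2 * sin (t / 2)"
    using t sin_ge_zero [of "t / 2"] by simp
  show ?thesis
    using power2_eq_imp_eq [OF sq norm_ge_zero nonneg] unfolding t_def .
qed

lemma norm_diff_le_geodesic_dist:
  assumes "x \<in> unit_sphere" "y \<in> unit_sphere"
  shows "norm (x - y) \<le> geodesic_dist x y"
  using norm_diff_eq_chord [OF assms] geodesic_dist_nonneg [OF assms]
    sin_x_le_x [of "geodesic_dist x y / 2"] by simp

text \<open>Jordan's inequality: the concave sine lies above its chord.\<close>

lemma geodesic_dist_le_norm_diff:
  assumes "x \<in> unit_sphere" "y \<in> unit_sphere"
  shows "geodesic_dist x y \<le> pi / 2 * norm (x - y)"
proof -
  have "concave_on {0..pi / 2} sin"
  proof (rule f''_le0_imp_concave)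
    show "DERIV cos x :> - sin x" "DERIV sin x :> cos x" for x :: real
      by (rule DERIV_cos DERIV_sin)+
    show "- sin x \<le> 0" if "x \<in> {0..pi / 2}" for x :: real
      using that sin_ge_zero [of x] by auto
  qed simp
  moreover have "geodesic_dist x y / 2 \<in> {0..pi / 2}"
    using arccos_ubound [of "x \<bullet> y"] geodesic_dist_nonneg [OF assms]
      abs_inner_unit_sphere_le_1 [OF assms] by (auto simp: geodesic_dist_def)
  ultimately have "sin (geodesic_dist x y / 2) \<ge> (sin (pi / 2) - sin 0) / (pi / 2 - 0) * (geodesic_dist x y / 2 - 0) + sin 0"
    by (rule concave_onD_Icc')
  then show ?thesis
    by (simp add: norm_diff_eq_chord [OF assms] field_simps)
qed

text \<open>
  This is the point where the sharp constant comes from. Of the two maps only \<open>u\<close> is known to send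
  \<open>x\<close> and \<open>- x\<close> to antipodes; that \<open>v\<close> does so too is forced by its surjectivity. All distances
  are compared through \<open>p + q \<le> 2 r\<close>, which follows from \<open>p\<^sup>2 + q\<^sup>2 \<le> 2 r\<^sup>2\<close> and is an equality only for
  \<open>p = q = r\<close>.
\<close>

lemma antipode_rigidity:
  fixes u v :: "'a::euclidean_space \<Rightarrow> 'a"
  assumes u: "u \<in> unit_sphere \<rightarrow> unit_sphere" and v: "v \<in> unit_sphere \<rightarrow> unit_sphere"
    and vsurj: "\<And>y. y \<in> unit_sphere \<Longrightarrow> \<exists>x\<in>unit_sphere. v x = y"
    and c: "0 \<le> c" "c \<le> 1"
    and contr: "\<And>x y. \<lbrakk>x \<in> unit_sphere; y \<in> unit_sphere\<rbrakk> \<Longrightarrow>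
       (geodesic_dist (u x) (u y))\<^sup>2 + (geodesic_dist (v x) (v y))\<^sup>2 \<le> 2 * (c * geodesic_dist x y)\<^sup>2"
    and x: "x \<in> unit_sphere" "u (- x) = - u x"
  shows "c = 1"
    and "z \<in> unit_sphere \<Longrightarrow> u x \<bullet> u z = x \<bullet> z"
    and "z \<in> unit_sphere \<Longrightarrow> v x \<bullet> v z = x \<bullet> z"
proof -
  have uS: "u y \<in> unit_sphere" and vS: "v y \<in> unit_sphere" if "y \<in> unit_sphere" for y
    using u v that by auto
  have mx: "- x \<in> unit_sphere"
    using x by simp
  have sum: "geodesic_dist (u y) (u z) + geodesic_dist (v y) (v z) \<le> 2 * (c * geodesic_dist y z)"
    if "y \<in> unit_sphere" "z \<in> unit_sphere" for y z
  proof -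
    define p q r where "p = geodesic_dist (u y) (u z)" and "q = geodesic_dist (v y) (v z)"
      and "r = c * geodesic_dist y z"
    have r: "r \<ge> 0" "p\<^sup>2 + q\<^sup>2 \<le> 2 * r\<^sup>2"
      using contr [OF that] c geodesic_dist_nonneg [OF that] by (auto simp: p_def q_def r_def)
    have "(p + q)\<^sup>2 \<le> (p + q)\<^sup>2 + (p - q)\<^sup>2"
      by simp
    also have "\<dots> = 2 * (p\<^sup>2 + q\<^sup>2)"
      by (simp add: power2_eq_square algebra_simps)
    also have "\<dots> \<le> 2 * (2 * r\<^sup>2)"
      using r(2) by (intro mult_left_mono) auto
    also have "\<dots> = (2 * r)\<^sup>2"
      by (simp add: power_mult_distrib)
    finally have "(p + q)\<^sup>2 \<le> (2 * r)\<^sup>2" .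
    then have "p + q \<le> 2 * r"
      by (rule power2_le_imp_le) (use r(1) in simp)
    then show ?thesis
      by (simp add: p_def q_def r_def)
  qed
  have ux: "geodesic_dist (u (- x)) (u z) = pi - geodesic_dist (u x) (u z)" if "z \<in> unit_sphere" for z
    unfolding x(2) using that x(1) uS by (intro geodesic_dist_antipode) auto
  \<comment> \<open>The \<open>u\<close>-distances from \<open>u z\<close> to the two antipodes contribute exactly \<open>pi\<close>.\<close>
  have total: "pi + geodesic_dist (v x) (v z) + geodesic_dist (v (- x)) (v z) \<le> 2 * (c * pi)"
    if "z \<in> unit_sphere" for z
  proof -
    have "c * geodesic_dist (- x) z = c * pi - c * geodesic_dist x z"
      unfolding geodesic_dist_antipode [OF x(1) that] by (rule right_diff_distrib)
    then show ?thesis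
      using sum [OF x(1) that] sum [OF mx that] ux [OF that] by linarith
  qed
  have cpi: "c * pi \<le> pi"
    using c by simp
  have vx: "v (- x) = - v x"
  proof (rule ccontr)
    assume "v (- x) \<noteq> - v x"
    then have nz: "v x + v (- x) \<noteq> 0"
      by (metis add_eq_0_iff)
    \<comment> \<open>The distances from \<open>v x\<close> and \<open>v (- x)\<close> to the point opposite to their midpoint add up to more
      than \<open>pi\<close>.\<close>
    then obtain z where z: "z \<in> unit_sphere" "v z = - sgn (v x + v (- x))"
      using vsurj [of "- sgn (v x + v (- x))"] by (auto simp: norm_sgn)
    have "v x \<bullet> v z + v (- x) \<bullet> v z = - norm (v x + v (- x))"
      using nz unfolding z(2) inner_add_left [symmetric]
      by (simp add: sgn_div_norm dot_square_norm power2_eq_square)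
    moreover have "norm (v x + v (- x)) > 0"
      using nz by simp
    ultimately have "v (- x) \<bullet> v z < - v x \<bullet> v z"
      unfolding inner_minus_left by linarith
    then have "arccos (- v x \<bullet> v z) < arccos (v (- x) \<bullet> v z)"
      using abs_inner_unit_sphere_le_1 [OF vS vS, OF x(1) z(1)]
        abs_inner_unit_sphere_le_1 [OF vS vS, OF mx z(1)] by (intro arccos_less_arccos) auto
    then have "geodesic_dist (- v x) (v z) < geodesic_dist (v (- x)) (v z)"
      by (simp add: geodesic_dist_def)
    then have "pi < geodesic_dist (v x) (v z) + geodesic_dist (v (- x)) (v z)"
      using geodesic_dist_antipode [OF vS vS, OF x(1) z(1)] by simp
    then show False
      using total [OF z(1)] cpi by linarith
  qed
  have vx': "geodesic_dist (v (- x)) (v z) = pi - geodesic_dist (v x) (v z)" if "z \<in> unit_sphere" for z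
    unfolding vx using that x(1) vS by (intro geodesic_dist_antipode) auto
  have "2 * pi \<le> 2 * (c * pi)"
    using total [OF x(1)] vx' [OF x(1)] by linarith
  then show c1: "c = 1"
    using c by simp
  have both: "u x \<bullet> u z = x \<bullet> z \<and> v x \<bullet> v z = x \<bullet> z" if "z \<in> unit_sphere"
  proof -
    define p q r where "p = geodesic_dist (u x) (u z)" and "q = geodesic_dist (v x) (v z)"
      and "r = geodesic_dist x z"
    have "p + q \<le> 2 * r" "(pi - p) + (pi - q) \<le> 2 * (pi - r)"
      using sum [OF x(1) that] sum [OF mx that] ux [OF that] vx' [OF that]
        geodesic_dist_antipode [OF x(1) that] c1 by (simp_all add: p_def q_def r_def)
    then have pq: "q = 2 * r - p"
      by simp
    have "p\<^sup>2 + q\<^sup>2 \<le> 2 * r\<^sup>2"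
      using contr [OF x(1) that] c1 by (simp add: p_def q_def r_def)
    then have "(p - r)\<^sup>2 \<le> 0"
      unfolding pq by (simp add: power2_eq_square algebra_simps)
    then have "p = r" "q = r"
      using pq by auto
    then show ?thesis
      using geodesic_dist_eq_iff [OF uS [OF x(1)] uS [OF that] x(1) that]
        geodesic_dist_eq_iff [OF vS [OF x(1)] vS [OF that] x(1) that] by (simp add: p_def q_def r_def)
  qed
  show "z \<in> unit_sphere \<Longrightarrow> u x \<bullet> u z = x \<bullet> z" "z \<in> unit_sphere \<Longrightarrow> v x \<bullet> v z = x \<bullet> z"
    using both by auto
qed

section \<open>Rigidity\<close>

text \<open>
  That \<open>x + a x\<close> lies in \<open>T\<close> means that \<open>a\<close> negates the component orthogonal to \<open>T\<close>, and the last
  property that it keeps the component in \<open>T\<close>.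
\<close>

lemma subspace_reflection:
  fixes T :: "'a::euclidean_space set"
  assumes T: "subspace T" and ne: "T \<noteq> UNIV"
  obtains a w where "orthogonal_transformation a" "\<And>x. a (a x) = x" "norm w = 1" "a w = - w"
    "\<And>x. x + a x \<in> T" "\<And>x y. y \<in> T \<Longrightarrow> y \<bullet> a x = y \<bullet> x"
proof -
  obtain B where B: "B \<subseteq> T" "pairwise orthogonal B" "\<And>x. x \<in> B \<Longrightarrow> norm x = 1"
    "independent B" "span B = T"
    using orthonormal_basis_subspace [OF T] by metis
  have fin: "finite B"
    using B(4) finiteI_independent by blast
  define P where "P x = (\<Sum>b\<in>B. (x \<bullet> b) *\<^sub>R b)" for x
  define a where "a x = 2 *\<^sub>R P x - x" for x
  have PT: "P x \<in> T" for x
    unfolding P_def using T B(1) by (intro subspace_sum subspace_scale) auto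
  have PP: "P y = y" if "y \<in> T" for y
    unfolding P_def using B fin that by (intro orthonormal_basis_expand) auto
  have sym: "P x \<bullet> y = x \<bullet> P y" for x y
    unfolding P_def by (simp add: inner_sum_left inner_sum_right inner_commute mult.commute)
  have lin: "linear P"
    unfolding P_def by (intro linear_compose_sum ballI linearI) (simp_all add: algebra_simps inner_add_left)
  obtain w0 where w0: "w0 \<noteq> 0" "\<And>y. y \<in> T \<Longrightarrow> orthogonal w0 y"
    using orthogonal_to_subspace_exists_gen [of T UNIV] T ne by (auto simp: span_eq_iff [THEN iffD2])
  show thesis
  proof
    show "orthogonal_transformation a"
      unfolding orthogonal_transformation_def
    proof
      show "linear a"
        unfolding a_def using lin by (intro linear_compose_sub linear_compose_scale_right linear_ident) auto
      show "\<forall>x y. a x \<bullet> a y = x \<bullet> y"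
        by (simp add: a_def inner_diff_left inner_diff_right sym PP PT)
    qed
    show "a (a x) = x" for x
    proof -
      have "P (a x) = P x"
        by (simp add: a_def linear_diff [OF lin] linear_scale [OF lin] PP PT) (simp add: scaleR_2)
      then show ?thesis
        by (simp add: a_def)
    qed
    show "norm (sgn w0) = 1"
      using w0 by (simp add: norm_sgn)
    have "P (sgn w0) = 0"
      using w0(2) B(1) by (auto simp: P_def sgn_div_norm orthogonal_def intro!: sum.neutral)
    then show "a (sgn w0) = - sgn w0"
      by (simp add: a_def)
    show "x + a x \<in> T" for x
      using PT T by (simp add: a_def subspace_scale)
    show "y \<bullet> a x = y \<bullet> x" if "y \<in> T" for x y
      using that sym [of y x] PP [OF that] by (simp add: a_def inner_diff_right)
  qed
qed

text \<open>
  The subspace \<open>T\<close> of vectors \<open>w\<close> for which \<open>w \<bullet> z\<close> can be read off linearly from \<open>u z\<close> and from \<open>v z\<close>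
  contains all points where \<open>antipode_rigidity\<close> applies. Such points exist in the orthogonal
  complement of \<open>T\<close> as long as this is not zero, so \<open>T\<close> is the whole space.
\<close>

lemma contraction_pair_is_isometric:
  fixes u v :: "'a::euclidean_space \<Rightarrow> 'a"
  assumes dim: "DIM('a) \<ge> 2"
    and u: "homotopic_with_canon (\<lambda>_. True) unit_sphere unit_sphere u id"
    and v: "homotopic_with_canon (\<lambda>_. True) unit_sphere unit_sphere v id"
    and c: "0 \<le> c" "c \<le> 1"
    and contr: "\<And>x y. \<lbrakk>x \<in> unit_sphere; y \<in> unit_sphere\<rbrakk> \<Longrightarrow>
       (geodesic_dist (u x) (u y))\<^sup>2 + (geodesic_dist (v x) (v y))\<^sup>2 \<le> 2 * (c * geodesic_dist x y)\<^sup>2"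
  shows "c = 1"
    and "\<And>x y. \<lbrakk>x \<in> unit_sphere; y \<in> unit_sphere\<rbrakk> \<Longrightarrow> u x \<bullet> u y = x \<bullet> y"
    and "\<And>x y. \<lbrakk>x \<in> unit_sphere; y \<in> unit_sphere\<rbrakk> \<Longrightarrow> v x \<bullet> v y = x \<bullet> y"
proof -
  have uS: "u \<in> unit_sphere \<rightarrow> unit_sphere" and vS: "v \<in> unit_sphere \<rightarrow> unit_sphere"
    using homotopic_with_imp_funspace1 [OF u] homotopic_with_imp_funspace1 [OF v] by auto
  have usurj: "\<exists>x\<in>unit_sphere. u x = y" and vsurj: "\<exists>x\<in>unit_sphere. v x = y" if "y \<in> unit_sphere" for y
    using that by (fact sphere_map_homotopic_id_surj [OF u] sphere_map_homotopic_id_surj [OF v])+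
  have lip: "norm (u x - u y) \<le> pi * norm (x - y)" if xy: "x \<in> unit_sphere" "y \<in> unit_sphere" for x y
  proof -
    have S: "u x \<in> unit_sphere" "u y \<in> unit_sphere"
      using uS xy by blast+
    have nonneg: "0 \<le> c * geodesic_dist x y"
      using c geodesic_dist_nonneg [OF xy] by simp
    have "(geodesic_dist (u x) (u y))\<^sup>2 \<le> (geodesic_dist (u x) (u y))\<^sup>2 + (geodesic_dist (v x) (v y))\<^sup>2"
      by simp
    also have "\<dots> \<le> 2 * (c * geodesic_dist x y)\<^sup>2"
      by (rule contr [OF xy])
    also have "\<dots> \<le> 4 * (c * geodesic_dist x y)\<^sup>2"
      by (intro mult_right_mono) auto
    also have "\<dots> = (2 * (c * geodesic_dist x y))\<^sup>2"
      by (simp add: power_mult_distrib)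
    finally have "(geodesic_dist (u x) (u y))\<^sup>2 \<le> (2 * (c * geodesic_dist x y))\<^sup>2" .
    then have "geodesic_dist (u x) (u y) \<le> 2 * (c * geodesic_dist x y)"
      by (rule power2_le_imp_le) (use nonneg in simp)
    also have "\<dots> \<le> 2 * geodesic_dist x y"
      using c geodesic_dist_nonneg [OF xy] mult_right_mono [of c 1 "geodesic_dist x y"] by simp
    also have "\<dots> \<le> pi * norm (x - y)"
      using geodesic_dist_le_norm_diff [OF xy] by simp
    finally show ?thesis
      using norm_diff_le_geodesic_dist [OF S] by linarith
  qed
  have rigid: "c = 1" "\<And>z. z \<in> unit_sphere \<Longrightarrow> u x \<bullet> u z = x \<bullet> z"
      "\<And>z. z \<in> unit_sphere \<Longrightarrow> v x \<bullet> v z = x \<bullet> z"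
    if "x \<in> unit_sphere" "u (- x) = - u x" for x
  proof -
    note rigidity = antipode_rigidity [OF uS vS _ c _ that]
    show "c = 1"
      by (rule rigidity(1)) (fact vsurj contr)+
    show "u x \<bullet> u z = x \<bullet> z" if "z \<in> unit_sphere" for z
      by (rule rigidity(2)) (fact vsurj contr that)+
    show "v x \<bullet> v z = x \<bullet> z" if "z \<in> unit_sphere" for z
      by (rule rigidity(3)) (fact vsurj contr that)+
  qed
  define T where "T = {w. (\<exists>p. \<forall>z\<in>unit_sphere. p \<bullet> u z = w \<bullet> z) \<and> (\<exists>p. \<forall>z\<in>unit_sphere. p \<bullet> v z = w \<bullet> z)}"
  have sub: "subspace {w. \<exists>p. \<forall>z\<in>unit_sphere. p \<bullet> g z = w \<bullet> z}" for g :: "'a \<Rightarrow> 'a"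
  proof (unfold subspace_def, safe)
    show "\<exists>p. \<forall>z\<in>unit_sphere. p \<bullet> g z = 0 \<bullet> z"
      by (rule exI [of _ 0]) simp
    show "\<exists>r. \<forall>z\<in>unit_sphere. r \<bullet> g z = (x + y) \<bullet> z"
      if "\<forall>z\<in>unit_sphere. p \<bullet> g z = x \<bullet> z" "\<forall>z\<in>unit_sphere. q \<bullet> g z = y \<bullet> z" for x y p q
      using that by (intro exI [of _ "p + q"]) (simp add: inner_add_left)
    show "\<exists>r. \<forall>z\<in>unit_sphere. r \<bullet> g z = (k *\<^sub>R x) \<bullet> z"
      if "\<forall>z\<in>unit_sphere. p \<bullet> g z = x \<bullet> z" for k x p
      using that by (intro exI [of _ "k *\<^sub>R p"]) simp
  qed
  have "subspace T"
    unfolding T_def Collect_conj_eq by (intro subspace_inter sub)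
  have minus_id: "orthogonal_transformation (\<lambda>x::'a. - x)"
    by (simp add: orthogonal_transformation_neg orthogonal_transformation_def)
  obtain w :: 'a where w: "norm w = 1"
    using vector_choose_size [of 1] by auto
  obtain x where x: "x \<in> unit_sphere" "u (- x) = - u x"
    using coincidence_with_antipode [OF dim minus_id _ w _ lip u] by auto
  show c1: "c = 1"
    using rigid(1) x by blast
  \<comment> \<open>The point \<open>z\<close> found below with the reflection in \<open>T\<close> is orthogonal to \<open>T\<close>: for \<open>y\<close> in \<open>T\<close>, the
    number \<open>y \<bullet> z\<close> equals \<open>y \<bullet> a z\<close> and is a linear function of \<open>u z\<close>, hence equal to its negative.\<close>
  have "T = UNIV"
  proof (rule ccontr)
    assume "T \<noteq> UNIV"
    then obtain a w where a: "orthogonal_transformation a" "\<And>x. a (a x) = x" "norm w = 1" "a w = - w"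
      and aT: "\<And>x. x + a x \<in> T" "\<And>x y. y \<in> T \<Longrightarrow> y \<bullet> a x = y \<bullet> x"
      using subspace_reflection [OF \<open>subspace T\<close>] by metis
    obtain z where z: "z \<in> unit_sphere" "u (a z) = - u z"
      using coincidence_with_antipode [OF dim a lip u] by blast
    have az: "a z \<in> unit_sphere"
      using z(1) orthogonal_transformation_norm [OF a(1), of z] by simp
    have orth: "y \<bullet> z = 0" if "y \<in> T" for y
    proof -
      obtain p where p: "\<forall>z\<in>unit_sphere. p \<bullet> u z = y \<bullet> z"
        using \<open>y \<in> T\<close> by (auto simp: T_def)
      have "y \<bullet> z = y \<bullet> a z"
        using aT(2) [OF that] by simp
      also have "\<dots> = p \<bullet> u (a z)"
        using p az by simp
      also have "\<dots> = - (y \<bullet> z)"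
        using p z by simp
      finally show ?thesis
        by simp
    qed
    have "(z + a z) \<bullet> (z + a z) = 0"
      using orth [OF aT(1) [of z]] aT(2) [OF aT(1) [of z]] by (simp add: inner_add_right)
    then have "a z = - z"
      by (simp add: eq_neg_iff_add_eq_0 add.commute)
    then have "u (- z) = - u z"
      using z by simp
    then have "z \<in> T"
      unfolding T_def using rigid(2,3) [OF z(1)] by blast
    then have "z \<bullet> z = 0"
      by (rule orth)
    then show False
      using z by simp
  qed
  \<comment> \<open>The vector \<open>p\<close> representing \<open>x\<close> has norm at most 1, as \<open>g\<close> attains its direction, and its inner
    product with the unit vector \<open>g x\<close> is 1. So it is \<open>g x\<close> itself.\<close>
  have isom: "g x \<bullet> g y = x \<bullet> y"
    if g: "g \<in> unit_sphere \<rightarrow> unit_sphere" "\<And>y. y \<in> unit_sphere \<Longrightarrow> \<exists>x\<in>unit_sphere. g x = y"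
      and p: "\<forall>z\<in>unit_sphere. p \<bullet> g z = x \<bullet> z"
      and xy: "x \<in> unit_sphere" "y \<in> unit_sphere" for g :: "'a \<Rightarrow> 'a" and p x y
  proof -
    have px: "p \<bullet> g x = 1"
      using p xy by (simp add: dot_square_norm)
    then have "p \<noteq> 0"
      by auto
    then obtain z where z: "z \<in> unit_sphere" "g z = sgn p"
      using g(2) [of "sgn p"] by (auto simp: norm_sgn)
    have "norm p = p \<bullet> g z"
      using \<open>p \<noteq> 0\<close> unfolding z(2) by (simp add: sgn_div_norm dot_square_norm power2_eq_square)
    also have "\<dots> = x \<bullet> z"
      using p z(1) by blast
    also have "\<dots> \<le> 1"
      using abs_inner_unit_sphere_le_1 [OF xy(1) z(1)] by linarith
    finally have "norm p \<le> 1" .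
    have gx: "norm (g x) = 1"
      using g(1) xy by (auto simp: Pi_iff)
    have "(p - g x) \<bullet> (p - g x) = p \<bullet> p - 2 * (p \<bullet> g x) + g x \<bullet> g x"
      by (simp add: inner_diff_left inner_diff_right inner_commute)
    also have "\<dots> = (norm p)\<^sup>2 - 1"
      using px gx by (simp add: dot_square_norm)
    also have "\<dots> \<le> 0"
      using \<open>norm p \<le> 1\<close> by (simp add: power_le_one)
    finally have "p = g x"
      using inner_ge_zero [of "p - g x"] by (metis antisym inner_eq_zero_iff right_minus_eq)
    then show ?thesis
      using p xy by blast
  qed
  show "u x \<bullet> u y = x \<bullet> y" "v x \<bullet> v y = x \<bullet> y" if "x \<in> unit_sphere" "y \<in> unit_sphere" for x y
  proof -
    have "x \<in> T"
      by (simp add: \<open>T = UNIV\<close>)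
    then obtain p q where "\<forall>z\<in>unit_sphere. p \<bullet> u z = x \<bullet> z" "\<forall>z\<in>unit_sphere. q \<bullet> v z = x \<bullet> z"
      unfolding T_def by blast
    then show "u x \<bullet> u y = x \<bullet> y" "v x \<bullet> v y = x \<bullet> y"
      using isom uS vS usurj vsurj that by blast+
  qed
qed

section \<open>The Lipschitz constant of the diagonal\<close>

lemma Lip_le_1_imp_nonexpanding:
  assumes "Lip X dX dY f \<le> 1" and "\<And>x y. \<lbrakk>x \<in> X; y \<in> X\<rbrakk> \<Longrightarrow> 0 \<le> dX x y" and "x \<in> X" "y \<in> X"
  shows "dY (f x) (f y) \<le> dX x y"
proof (rule field_le_epsilon)
  fix e :: real
  assume "e > 0"
  define \<epsilon> where "\<epsilon> = e / (dX x y + 1)"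
  have d: "0 \<le> dX x y"
    using assms by blast
  then have "\<epsilon> > 0"
    using \<open>e > 0\<close> by (simp add: \<epsilon>_def)
  then have "Lip X dX dY f < ereal (1 + \<epsilon>)"
    using assms(1) by (metis ereal_less(3) le_less_trans less_add_same_cancel1 one_ereal_def less_ereal.simps(1))
  then obtain c where c: "c < 1 + \<epsilon>" "\<forall>x\<in>X. \<forall>y\<in>X. dY (f x) (f y) \<le> c * dX x y"
    unfolding Lip_def by (auto simp: Inf_less_iff)
  then have "dY (f x) (f y) \<le> c * dX x y"
    using assms by blast
  also have "\<dots> \<le> (1 + \<epsilon>) * dX x y"
    using c(1) d by (intro mult_right_mono) auto
  also have "\<dots> = dX x y + e * (dX x y / (dX x y + 1))"
    by (simp add: \<epsilon>_def algebra_simps)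
  also have "\<dots> \<le> dX x y + e * 1"
    using d \<open>e > 0\<close> by (intro add_left_mono mult_left_mono) auto
  finally show "dY (f x) (f y) \<le> dX x y + e"
    by simp
qed

lemma isometric_inclusion_imp_distance_preserving:
  assumes "isometric_maps X d Y d f (\<lambda>p. p)" and "f \<in> X \<rightarrow> Y" and "x \<in> X" "y \<in> X"
  shows "d (f x) (f y) = d x y"
proof -
  obtain gX gY where X: "\<And>x y. \<lbrakk>x \<in> X; y \<in> X\<rbrakk> \<Longrightarrow> d (gX x) (gX y) = d x y"
    and Y: "\<And>p q. \<lbrakk>p \<in> Y; q \<in> Y\<rbrakk> \<Longrightarrow> d (gY p) (gY q) = d p q"
    and eq: "\<And>x. x \<in> X \<Longrightarrow> gY (f x) = gX x"
    using assms(1) unfolding isometric_maps_def self_isometry_def by metis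
  have "d (f x) (f y) = d (gY (f x)) (gY (f y))"
    using Y assms by (metis PiE)
  then show ?thesis
    using X eq assms by simp
qed

lemma sphere_prod_dist_diagonal:
  "sphere_prod_dist (x, x) (y, y) = sqrt (2 * (geodesic_dist x y)\<^sup>2)"
  by (simp add: sphere_prod_dist_def prod_dist_def)

lemma sphere_isometry_inverse:
  fixes u :: "'a::euclidean_space \<Rightarrow> 'a"
  assumes surj: "u ` unit_sphere = unit_sphere"
    and isom: "\<And>x y. \<lbrakk>x \<in> unit_sphere; y \<in> unit_sphere\<rbrakk> \<Longrightarrow> u x \<bullet> u y = x \<bullet> y"
  obtains u' where "u' ` unit_sphere = unit_sphere" "\<And>x. x \<in> unit_sphere \<Longrightarrow> u' (u x) = x"
    "\<And>x y. \<lbrakk>x \<in> unit_sphere; y \<in> unit_sphere\<rbrakk> \<Longrightarrow> u' x \<bullet> u' y = x \<bullet> y"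
proof -
  have "inj_on u unit_sphere"
  proof (rule inj_onI)
    fix x y
    assume xy: "x \<in> unit_sphere" "y \<in> unit_sphere" "u x = u y"
    have "x \<bullet> y = 1"
      using isom [OF xy(1) xy(2)] isom [OF xy(1) xy(1)] xy by (simp add: dot_square_norm)
    have "(x - y) \<bullet> (x - y) = x \<bullet> x - 2 * (x \<bullet> y) + y \<bullet> y"
      by (simp add: inner_diff_left inner_diff_right inner_commute)
    also have "\<dots> = 0"
      using xy \<open>x \<bullet> y = 1\<close> by (simp add: dot_square_norm)
    finally show "x = y"
      by simp
  qed
  then have bij: "bij_betw u unit_sphere unit_sphere"
    using surj by (simp add: bij_betw_def)
  define u' where "u' = inv_into unit_sphere u"
  have bij': "bij_betw u' unit_sphere unit_sphere"
    unfolding u'_def by (rule bij_betw_inv_into [OF bij])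
  have u'S: "u' y \<in> unit_sphere" and uu': "u (u' y) = y" if "y \<in> unit_sphere" for y
    using bij_betwE [OF bij'] bij_betw_inv_into_right [OF bij that] that unfolding u'_def by blast+
  show thesis
  proof
    show "u' ` unit_sphere = unit_sphere"
      using bij' by (simp add: bij_betw_def)
    show "u' (u x) = x" if "x \<in> unit_sphere" for x
      unfolding u'_def by (rule bij_betw_inv_into_left [OF bij that])
    show "u' x \<bullet> u' y = x \<bullet> y" if "x \<in> unit_sphere" "y \<in> unit_sphere" for x y
      using isom [OF u'S u'S, OF that] uu' that by metis
  qed
qed

text \<open>The isometry of the product undoes both components, and the one of the diagonal is the identity.\<close>

lemma isometric_maps_inclusion_of_components:
  fixes f :: "'a::euclidean_space \<times> 'a \<Rightarrow> 'a \<times> 'a"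
  assumes f: "\<And>x. x \<in> unit_sphere \<Longrightarrow> f (x, x) = (u x, v x)"
    and u: "u ` unit_sphere = unit_sphere"
      "\<And>x y. \<lbrakk>x \<in> unit_sphere; y \<in> unit_sphere\<rbrakk> \<Longrightarrow> u x \<bullet> u y = x \<bullet> y"
    and v: "v ` unit_sphere = unit_sphere"
      "\<And>x y. \<lbrakk>x \<in> unit_sphere; y \<in> unit_sphere\<rbrakk> \<Longrightarrow> v x \<bullet> v y = x \<bullet> y"
  shows "isometric_maps sphere_diagonal sphere_prod_dist (unit_sphere \<times> unit_sphere) sphere_prod_dist
           f (\<lambda>p. p)"
proof -
  obtain u' where u': "u' ` unit_sphere = unit_sphere" "\<And>x. x \<in> unit_sphere \<Longrightarrow> u' (u x) = x"
    "\<And>x y. \<lbrakk>x \<in> unit_sphere; y \<in> unit_sphere\<rbrakk> \<Longrightarrow> u' x \<bullet> u' y = x \<bullet> y"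
    using sphere_isometry_inverse [OF u] by blast
  obtain v' where v': "v' ` unit_sphere = unit_sphere" "\<And>x. x \<in> unit_sphere \<Longrightarrow> v' (v x) = x"
    "\<And>x y. \<lbrakk>x \<in> unit_sphere; y \<in> unit_sphere\<rbrakk> \<Longrightarrow> v' x \<bullet> v' y = x \<bullet> y"
    using sphere_isometry_inverse [OF v] by blast
  have "self_isometry sphere_diagonal sphere_prod_dist (\<lambda>p. p)"
    by (simp add: self_isometry_def)
  moreover have "self_isometry (unit_sphere \<times> unit_sphere) sphere_prod_dist (map_prod u' v')"
    using u' v' by (auto simp: self_isometry_def map_prod_surj_on sphere_prod_dist_def prod_dist_def
        geodesic_dist_def simp del: mem_sphere_0)
  moreover have "map_prod u' v' (f p) = p" if "p \<in> sphere_diagonal" for p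
    using that f u' v' by (auto simp: sphere_diagonal_def)
  ultimately show ?thesis
    unfolding isometric_maps_def by blast
qed

theorem theoremB:
  fixes n :: nat
    and f :: "'a::euclidean_space \<times> 'a \<Rightarrow> 'a \<times> 'a"
  assumes "n \<ge> 1"
    and "DIM('a) = n + 1"
    and "continuous_on sphere_diagonal f"
    and "f \<in> sphere_diagonal \<rightarrow> unit_sphere \<times> unit_sphere"
    and "homotopic_with_canon (\<lambda>_. True) sphere_diagonal (unit_sphere \<times> unit_sphere) f (\<lambda>p. p)"
  shows "Lip sphere_diagonal sphere_prod_dist sphere_prod_dist f \<ge> 1 \<and>
    (Lip sphere_diagonal sphere_prod_dist sphere_prod_dist f = 1 \<longleftrightarrow>
      isometric_maps sphere_diagonal sphere_prod_dist (unit_sphere \<times> unit_sphere) sphere_prod_dist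
        f (\<lambda>p. p))"
proof -
  let ?D = "sphere_diagonal :: ('a \<times> 'a) set" and ?d = "sphere_prod_dist :: 'a \<times> 'a \<Rightarrow> 'a \<times> 'a \<Rightarrow> real"
  define u v where "u = (\<lambda>x. fst (f (x, x)))" and "v = (\<lambda>x. snd (f (x, x)))"
  have f: "f (x, x) = (u x, v x)" for x
    by (simp add: u_def v_def)
  have dim: "DIM('a) \<ge> 2"
    using assms(1,2) by simp
  have diag: "homotopic_with_canon (\<lambda>_. True) unit_sphere (unit_sphere \<times> unit_sphere)
                (f \<circ> (\<lambda>x. (x, x))) ((\<lambda>p. p) \<circ> (\<lambda>x. (x, x)))"
    using assms(5) by (rule homotopic_with_compose_continuous_right)
      (auto simp: sphere_diagonal_def intro!: continuous_intros)
  have u: "homotopic_with_canon (\<lambda>_. True) unit_sphere unit_sphere u id"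
  proof -
    have "homotopic_with_canon (\<lambda>_. True) unit_sphere unit_sphere
            (fst \<circ> (f \<circ> (\<lambda>x. (x, x)))) (fst \<circ> ((\<lambda>p. p) \<circ> (\<lambda>x. (x, x))))"
      using diag by (rule homotopic_with_compose_continuous_left) (auto intro!: continuous_intros)
    then show ?thesis
      by (simp add: o_def u_def id_def)
  qed
  have v: "homotopic_with_canon (\<lambda>_. True) unit_sphere unit_sphere v id"
  proof -
    have "homotopic_with_canon (\<lambda>_. True) unit_sphere unit_sphere
            (snd \<circ> (f \<circ> (\<lambda>x. (x, x)))) (snd \<circ> ((\<lambda>p. p) \<circ> (\<lambda>x. (x, x))))"
      using diag by (rule homotopic_with_compose_continuous_left) (auto intro!: continuous_intros)
    then show ?thesis
      by (simp add: o_def v_def id_def)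
  qed
  have surj: "u ` unit_sphere = unit_sphere" "v ` unit_sphere = unit_sphere"
    using sphere_map_homotopic_id_surj [OF u] sphere_map_homotopic_id_surj [OF v]
      homotopic_with_imp_funspace1 [OF u] homotopic_with_imp_funspace1 [OF v] by fast+
  have D: "(x, x) \<in> ?D" if "x \<in> unit_sphere" for x
    using that by (auto simp: sphere_diagonal_def)
  have contr: "(geodesic_dist (u x) (u y))\<^sup>2 + (geodesic_dist (v x) (v y))\<^sup>2 \<le> 2 * (c * geodesic_dist x y)\<^sup>2"
    if c: "0 \<le> c" "\<And>p q. \<lbrakk>p \<in> ?D; q \<in> ?D\<rbrakk> \<Longrightarrow> ?d (f p) (f q) \<le> c * ?d p q"
      and xy: "x \<in> unit_sphere" "y \<in> unit_sphere" for c x y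
  proof -
    have "?d (f (x, x)) (f (y, y)) \<le> c * sqrt (2 * (geodesic_dist x y)\<^sup>2)"
      using c(2) [OF D D, OF xy] by (simp only: sphere_prod_dist_diagonal)
    also have "\<dots> = sqrt (2 * (c * geodesic_dist x y)\<^sup>2)"
      using c(1) by (simp add: power_mult_distrib real_sqrt_mult)
    finally show ?thesis
      by (simp add: f sphere_prod_dist_def prod_dist_def)
  qed
  have ge1: "Lip ?D ?d ?d f \<ge> 1"
    unfolding Lip_def
  proof (rule Inf_greatest, safe)
    fix c :: real
    assume c: "0 \<le> c" "\<forall>p\<in>?D. \<forall>q\<in>?D. ?d (f p) (f q) \<le> c * ?d p q"
    show "1 \<le> ereal c"
    proof (cases "c \<le> 1")
      case True
      have "c = 1"
        by (rule contraction_pair_is_isometric(1) [OF dim u v c(1) True]) (use contr c in blast)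
      then show ?thesis
        by (simp add: one_ereal_def)
    qed (simp add: one_ereal_def)
  qed
  have "Lip ?D ?d ?d f = 1 \<longleftrightarrow> isometric_maps ?D ?d (unit_sphere \<times> unit_sphere) ?d f (\<lambda>p. p)"
  proof
    assume "Lip ?D ?d ?d f = 1"
    then have "?d (f p) (f q) \<le> 1 * ?d p q" if "p \<in> ?D" "q \<in> ?D" for p q
      using Lip_le_1_imp_nonexpanding [of ?D ?d ?d f p q] that
      by (auto simp: sphere_prod_dist_def prod_dist_def)
    note contr1 = contr [of 1, OF zero_le_one this]
    show "isometric_maps ?D ?d (unit_sphere \<times> unit_sphere) ?d f (\<lambda>p. p)"
    proof (rule isometric_maps_inclusion_of_components [OF f surj(1) _ surj(2)])
      show "u x \<bullet> u y = x \<bullet> y" "v x \<bullet> v y = x \<bullet> y" if "x \<in> unit_sphere" "y \<in> unit_sphere" for x y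
        using contraction_pair_is_isometric(2,3) [OF dim u v, of 1 x y] contr1 that by auto
    qed
  next
    assume isom: "isometric_maps ?D ?d (unit_sphere \<times> unit_sphere) ?d f (\<lambda>p. p)"
    have "?d (f p) (f q) = ?d p q" if "p \<in> ?D" "q \<in> ?D" for p q
      using isometric_inclusion_imp_distance_preserving [OF isom assms(4) that] .
    then have "Lip ?D ?d ?d f \<le> ereal 1"
      unfolding Lip_def by (intro Inf_lower) force
    then show "Lip ?D ?d ?d f = 1"
      using ge1 by (simp add: one_ereal_def)
  qed
  with ge1 show ?thesis
    by blast
qed

end
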